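(* For every positive integer $x$, the number $\pi(x)$ of primes not exceeding $x$ is given by $$\pi(x)=-8\sum_{h=1}^{\infty}H_{-2h}(x)\sum_{i=1}^{h}\log\zeta(2i)\sum_{j=i}^{h}\frac{(-1)^{h-j}(2\pi)^{2h-2j}}{\zeta(2j-2i)\,(2h+2-2j)!}.$$
   Context: $\zeta$ is the Riemann zeta function, with $\zeta(0)=-1/2$ (analytic continuation). $H_{-2h}(x)=\sum_{n=1}^{x}n^{2h}$ is the sum of the $2h$-th powers of the first $x$ positive integers. The outer series over $h$ is summed in order of increasing $h$. *)

theory Defs
  imports "HOL-Complex_Analysis.Complex_Analysis" "HOL-Computational_Algebra.Primes"
begin

definition zeta_series :: "complex \<Rightarrow> complex" where
  "zeta_series s = (\<Sum>n. of_nat (Suc n) powr (- s))"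

(* The value 0 at the pole is only a convention; it makes the continuation unique as a total
   function.  The statement evaluates zeta at 0 and at the positive even integers only. *)
definition zeta_continuation :: "complex \<Rightarrow> complex" where
  "zeta_continuation = (THE f. f holomorphic_on (- {1}) \<and>
     (\<forall>s. Re s > 1 \<longrightarrow> f s = zeta_series s) \<and> f 1 = 0)"

definition zeta :: "complex \<Rightarrow> complex" where
  "zeta s = (if Re s > 1 then zeta_series s else zeta_continuation s)"

(* H_{-m}(x) for a natural number m: the generalised harmonic number with negative index. *)
definition power_sum :: "nat \<Rightarrow> nat \<Rightarrow> nat" where
  "power_sum m x = (\<Sum>n=1..x. n ^ m)"

definition prime_count :: "nat \<Rightarrow> nat" where
  "prime_count x = card {p :: nat. prime p \<and> p \<le> x}"

end

theory Submission
  imports Defs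
begin

text \<open>
  With \<open>A(w) = \<Sum> log \<zeta>(2i) w\<^sup>i\<close>, \<open>B(w) = \<Sum> w\<^sup>k/\<zeta>(2k)\<close> and
  \<open>C(z\<^sup>2) = (1 - cos 2\<pi>z)/(2\<pi>z)\<^sup>2\<close>, the inner double sum is the \<open>h\<close>-th coefficient of \<open>A B C\<close>.
  Expanding \<open>log \<zeta>\<close> over prime powers and \<open>1/\<zeta>\<close> over squarefree numbers shows that \<open>A\<close> and \<open>B\<close> have
  at most simple poles, at the points \<open>n\<^sup>2\<close> with \<open>n\<close> a prime power and squarefree, respectively.
  Since \<open>C = E\<^sup>2/2\<close> with \<open>E(z\<^sup>2) = sin(\<pi>z)/(\<pi>z)\<close>, the factors \<open>E A\<close> and \<open>E B\<close> are entire, and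
  \<open>A B C\<close> vanishes at \<open>n\<^sup>2\<close> unless both poles are present, that is unless \<open>n\<close> is prime, where its
  value is \<open>-1/8\<close>. Summing the Taylor series at \<open>n\<^sup>2\<close> over \<open>n \<le> x\<close> counts the primes.
\<close>


section \<open>The entire function \<open>sinc_fps\<close>, its values and slopes at the squares,
  and its square\<close>

text \<open>The encoding is \<open>sinc_fps(z\<^sup>2) = sin(\<pi>z)/(\<pi>z)\<close>: working in the variable \<open>w = z\<^sup>2\<close> gives
  every \<open>n\<^sup>2\<close> with \<open>n > 0\<close> as a simple zero.\<close>
definition sinc_fps :: "complex fps" where
  "sinc_fps = Abs_fps (\<lambda>m. (- 1) ^ m * of_real pi ^ (2 * m) / fact (2 * m + 1))"

lemma sinc_fps_sums:
  "(\<lambda>m. fps_nth sinc_fps m * (z ^ 2) ^ m * (of_real pi * z)) sums sin (of_real pi * z)"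
proof -
  let ?f = "\<lambda>n. sin_coeff n *\<^sub>R (of_real pi * z) ^ n"
  have "?f n = 0" if "n \<notin> range (\<lambda>m. 2 * m + 1)" for n
    using that by (auto simp: sin_coeff_def elim!: oddE)
  then have "(\<lambda>m. ?f (2 * m + 1)) sums sin (of_real pi * z)"
    using sin_converges[of "of_real pi * z"]
    by (subst sums_mono_reindex) (auto simp: strict_mono_def)
  moreover have "sin_coeff (2 * m + 1) *\<^sub>R (of_real pi * z) ^ (2 * m + 1)
      = fps_nth sinc_fps m * (z ^ 2) ^ m * (of_real pi * z)" for m
    by (simp add: sinc_fps_def sin_coeff_def scaleR_conv_of_real power_mult_distrib power_mult)
  ultimately show ?thesis
    by simp
qed

text \<open>Convergence at arbitrarily large positive \<open>r\<close> suffices. With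
  \<open>z\<close> a square root of \<open>r\<close>, the sine series at \<open>pi * z\<close> is
  the series in question times the nonzero constant \<open>pi * z\<close>, which can be divided
  out.\<close>

lemma fps_conv_radius_sinc [simp]: "fps_conv_radius sinc_fps = \<infinity>"
proof -
  have "summable (\<lambda>m. fps_nth sinc_fps m * of_real r ^ m)" if "r > 0" for r
  proof -
    define z where "z = csqrt (of_real r)"
    have z: "z ^ 2 = of_real r" "z \<noteq> 0"
      unfolding z_def by (simp only: power2_csqrt, use that in simp)
    define u where "u = of_real pi * z"
    have u: "u \<noteq> 0" using z by (simp add: u_def)
    have "summable (\<lambda>m. fps_nth sinc_fps m * (z ^ 2) ^ m * u)"
      unfolding u_def by (rule sums_summable[OF sinc_fps_sums])
    from summable_mult2[OF this, of "inverse u"] show ?thesis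
      using z u by (simp add: mult.assoc)
  qed
  then have "fps_conv_radius sinc_fps \<ge> \<infinity>"
    unfolding fps_conv_radius_def by (intro conv_radius_geI_ex') auto
  then show ?thesis by simp
qed

lemma eval_sinc_fps:
  "eval_fps sinc_fps (z ^ 2) * (of_real pi * z) = sin (of_real pi * z)"
proof -
  have "summable (\<lambda>m. fps_nth sinc_fps m * (z ^ 2) ^ m)"
    by (rule summable_fps) simp
  then show ?thesis
    using sinc_fps_sums[of z] unfolding eval_fps_def
    by (simp add: sums_iff suminf_mult2)
qed

lemma sin_pi_of_nat: "sin (of_real pi * of_nat n :: complex) = 0"
proof -
  have "sin (of_real pi * of_nat n :: complex) = of_real (sin (pi * real n))"
    by (metis of_real_mult of_real_of_nat_eq sin_of_real)
  then show ?thesis by (simp add: sin_npi2)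
qed

lemma cos_pi_of_nat: "cos (of_real pi * of_nat n :: complex) = (- 1) ^ n"
proof -
  have "cos (of_real pi * of_nat n :: complex) = of_real (cos (pi * real n))"
    by (metis of_real_mult of_real_of_nat_eq cos_of_real)
  then show ?thesis by (simp add: cos_npi2)
qed

lemma eval_sinc_fps_nat_square:
  assumes "n > 0"
  shows "eval_fps sinc_fps (of_nat n ^ 2) = 0"
  using eval_sinc_fps[of "of_nat n"] assms by (simp add: sin_pi_of_nat)

text \<open>Both sides of \<open>eval_sinc_fps\<close> are differentiated at \<open>z = n\<close>.
  The product rule term containing the value at \<open>n ^ 2\<close> vanishes, which leaves
  \<open>D * 2n * pi n = pi * (- 1) ^ n\<close>.\<close>

lemma deriv_sinc_fps_nat_square:
  assumes "n > 0"
  shows "deriv (eval_fps sinc_fps) (of_nat n ^ 2) = (- 1) ^ n / (2 * of_nat n ^ 2)"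
proof -
  define D where "D = deriv (eval_fps sinc_fps) (of_nat n ^ 2)"
  have "(eval_fps sinc_fps has_field_derivative eval_fps (fps_deriv sinc_fps) (of_nat n ^ 2)) (at (of_nat n ^ 2))"
    by (rule has_field_derivative_eval_fps) simp
  then have "(eval_fps sinc_fps has_field_derivative D) (at (of_nat n ^ 2))"
    unfolding D_def by (simp add: DERIV_imp_deriv)
  moreover have "((\<lambda>z. z ^ 2) has_field_derivative 2 * of_nat n) (at (of_nat n :: complex))"
    by (auto intro!: derivative_eq_intros)
  ultimately have "((\<lambda>z. eval_fps sinc_fps (z ^ 2)) has_field_derivative D * (2 * of_nat n)) (at (of_nat n))"
    by (rule DERIV_chain2)
  moreover have "((\<lambda>z. of_real pi * z) has_field_derivative of_real pi) (at (of_nat n :: complex))"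
    by (auto intro!: derivative_eq_intros)
  ultimately have "((\<lambda>z. eval_fps sinc_fps (z ^ 2) * (of_real pi * z)) has_field_derivative
      (D * (2 * of_nat n)) * (of_real pi * of_nat n) + of_real pi * eval_fps sinc_fps (of_nat n ^ 2)) (at (of_nat n))"
    by (rule DERIV_mult)
  then have "((\<lambda>z. sin (of_real pi * z)) has_field_derivative
      (D * (2 * of_nat n)) * (of_real pi * of_nat n)) (at (of_nat n))"
    unfolding eval_sinc_fps eval_sinc_fps_nat_square[OF assms] by simp
  moreover have "((\<lambda>z. sin (of_real pi * z)) has_field_derivative of_real pi * cos (of_real pi * of_nat n))
      (at (of_nat n :: complex))"
    by (auto intro!: derivative_eq_intros)
  ultimately have "(D * (2 * of_nat n)) * (of_real pi * of_nat n) = of_real pi * (- 1) ^ n"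
    unfolding cos_pi_of_nat by (rule DERIV_unique)
  then show ?thesis
    using assms unfolding D_def[symmetric] by (simp add: field_simps power2_eq_square)
qed

text \<open>This is the identity \<open>2 sin^2 u = 1 - cos 2u\<close> on coefficients. It produces
  the factor \<open>(2 pi) ^ (2m) / (2m + 2)!\<close> of the target formula, up to the sign and a
  factor 2.\<close>

lemma sinc_fps_square_nth:
  "fps_nth (sinc_fps * sinc_fps) m = 2 * ((- 1) ^ m * (2 * of_real pi) ^ (2 * m) / fact (2 * m + 2))"
proof -
  have *: "fps_nth sinc_fps j * fps_nth sinc_fps (m - j)
      = (- 1) ^ m * of_real pi ^ (2 * m) / fact (2 * m + 2) * of_nat ((2 * m + 2) choose (2 * j + 1))"
    if "j \<le> m" for j
  proof -
    have "2 * m + 2 - (2 * j + 1) = 2 * (m - j) + 1" using that by simp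
    then have "of_nat ((2 * m + 2) choose (2 * j + 1))
        = (fact (2 * m + 2) / (fact (2 * j + 1) * fact (2 * (m - j) + 1)) :: complex)"
      using that by (subst binomial_fact) auto
    moreover have "(- 1) ^ j * (- 1) ^ (m - j) = ((- 1) ^ m :: complex)"
      "of_real pi ^ (2 * j) * of_real pi ^ (2 * (m - j)) = (of_real pi ^ (2 * m) :: complex)"
      using that by (simp_all flip: power_add add: right_diff_distrib')
    \<comment> \<open>Inserting \<open>F / F\<close> with \<open>F = (2m + 2)!\<close> turns the two
      factorials of the Cauchy product into a binomial coefficient with odd lower index.\<close>
    moreover have "(s1 * p1 / F1) * (s2 * p2 / F2) = s1 * s2 * (p1 * p2) / F * (F / (F1 * F2))"
      if "F \<noteq> 0" for s1 s2 p1 p2 F1 F2 F :: complex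
      using that by simp
    from this[OF fact_nonzero] have "fps_nth sinc_fps j * fps_nth sinc_fps (m - j)
        = (- 1) ^ j * (- 1) ^ (m - j) * (of_real pi ^ (2 * j) * of_real pi ^ (2 * (m - j)))
          / fact (2 * m + 2) * (fact (2 * m + 2) / (fact (2 * j + 1) * fact (2 * (m - j) + 1)))"
      unfolding sinc_fps_def fps_nth_Abs_fps .
    ultimately show ?thesis
      by presburger
  qed
  have "(\<Sum>j\<le>m. of_nat ((2 * m + 2) choose (2 * j + 1)) :: complex)
      = (\<Sum>i\<in>(\<lambda>j. 2 * j + 1) ` {..m}. of_nat ((2 * m + 2) choose i))"
    by (subst sum.reindex) (auto simp: inj_on_def)
  also have "\<dots> = (\<Sum>i\<le>2 * m + 2. if odd i then of_nat ((2 * m + 2) choose i) else 0)"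
  proof (rule sum.mono_neutral_cong_left)
    show "\<forall>i\<in>{..2 * m + 2} - (\<lambda>j. 2 * j + 1) ` {..m}. (if odd i then of_nat ((2 * m + 2) choose i) else 0) = (0 :: complex)"
    proof
      fix i assume i: "i \<in> {..2 * m + 2} - (\<lambda>j. 2 * j + 1) ` {..m}"
      have "even i"
      proof (rule ccontr)
        assume "odd i"
        then obtain k where "i = 2 * k + 1" by (elim oddE)
        with i show False by auto
      qed
      then show "(if odd i then of_nat ((2 * m + 2) choose i) else 0) = (0 :: complex)" by simp
    qed
  qed auto
  \<comment> \<open>The odd-index binomial coefficients make up half of the row sum
    \<open>2 ^ (2m + 2)\<close>.\<close>
  finally have **: "2 * (\<Sum>j\<le>m. of_nat ((2 * m + 2) choose (2 * j + 1)) :: complex) = 2 ^ (2 * m + 2)"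
    using choose_odd_sum[of "2 * m + 2", where 'a = complex] by simp
  have "fps_nth (sinc_fps * sinc_fps) m
      = (- 1) ^ m * of_real pi ^ (2 * m) / fact (2 * m + 2) * (\<Sum>j\<le>m. of_nat ((2 * m + 2) choose (2 * j + 1)))"
    unfolding fps_mult_nth atLeast0AtMost sum_distrib_left by (intro sum.cong refl *) auto
  also have "(\<Sum>j\<le>m. of_nat ((2 * m + 2) choose (2 * j + 1)) :: complex) = 2 * 2 ^ (2 * m)"
    using ** by simp
  finally show ?thesis
    by (simp add: power_mult_distrib)
qed

section \<open>Cancelling the pole of a geometric series by a zero of
  \<open>sinc_fps\<close>\<close>

lemma entire_fps_divide_linear:
  fixes f :: "complex fps"
  assumes rad: "fps_conv_radius f = \<infinity>" and zero: "eval_fps f a = 0"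
  obtains g where "f = (fps_X - fps_const a) * g" "fps_conv_radius g = \<infinity>"
    "eval_fps g a = deriv (eval_fps f) a"
proof -
  \<comment> \<open>The difference quotient has a removable singularity at \<open>a\<close>, filled
    with the derivative. So \<open>h\<close> is entire and its expansion at 0 represents it
    everywhere.\<close>
  define h where "h = (\<lambda>w. if w = a then deriv (eval_fps f) a else (eval_fps f w - eval_fps f a) / (w - a))"
  define g where "g = fps_expansion h 0"
  have "h holomorphic_on eball 0 \<infinity>"
    unfolding h_def using rad by (intro pole_lemma_open holomorphic_on_eval_fps) auto
  from conv_radius_fps_expansion[OF this] eval_fps_expansion'[OF this]
  have g: "fps_conv_radius g = \<infinity>" "eval_fps g w = h w" for w
    unfolding g_def by auto
  have lin: "fps_conv_radius (fps_X - fps_const a) = \<infinity>"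
    using fps_conv_radius_diff[of fps_X "fps_const a"] by simp
  have prod: "fps_conv_radius ((fps_X - fps_const a) * g) = \<infinity>"
    using fps_conv_radius_mult[of "fps_X - fps_const a" g] lin g(1) by simp
  have "eval_fps f w = eval_fps ((fps_X - fps_const a) * g) w" for w
    using lin g zero by (simp add: eval_fps_mult eval_fps_diff h_def)
  then have "f = (fps_X - fps_const a) * g"
    using rad prod by (intro eval_fps_eqD) auto
  moreover have "eval_fps g a = deriv (eval_fps f) a"
    by (simp add: g h_def)
  ultimately show thesis using that g(1) by blast
qed

text \<open>The expansion of \<open>w / (q^2 - w)\<close>, with a simple pole at \<open>q^2\<close>.
  The constant term is dropped because the coefficient formulas for \<open>ln zeta\<close> and
  \<open>1 / zeta\<close> are used for \<open>i > 0\<close> only.\<close>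

definition power_fps :: "nat \<Rightarrow> complex fps" where
  "power_fps q = Abs_fps (\<lambda>i. if i = 0 then 0 else (1 / of_nat q ^ 2) ^ i)"

lemma power_fps_mult:
  assumes "q > 0"
  shows "(fps_X - fps_const (of_nat q ^ 2)) * power_fps q = - fps_X"
proof (rule fps_ext)
  fix i
  show "fps_nth ((fps_X - fps_const (of_nat q ^ 2)) * power_fps q) i = fps_nth (- fps_X) i"
    using assms by (cases i) (auto simp: power_fps_def left_diff_distrib field_simps)
qed

text \<open>Writing \<open>sinc_fps = (w - q^2) g\<close>, the product is \<open>- w g(w)\<close>,
  which is entire. At \<open>q^2\<close> it equals \<open>- q^2\<close> times the slope of
  \<open>sinc_fps\<close> there; at any other square \<open>n^2\<close> the factor \<open>g\<close>
  inherits the zero of \<open>sinc_fps\<close>.\<close>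

lemma sinc_times_power_fps:
  assumes "q > 0"
  shows "fps_conv_radius (sinc_fps * power_fps q) = \<infinity>"
    and "n > 0 \<Longrightarrow> eval_fps (sinc_fps * power_fps q) (of_nat n ^ 2) = (if q = n then - ((- 1) ^ n / 2) else 0)"
proof -
  let ?L = "fps_X - fps_const (of_nat q ^ 2) :: complex fps"
  obtain g where g: "sinc_fps = ?L * g" "fps_conv_radius g = \<infinity>"
    "eval_fps g (of_nat q ^ 2) = deriv (eval_fps sinc_fps) (of_nat q ^ 2)"
    using entire_fps_divide_linear[of sinc_fps] eval_sinc_fps_nat_square[OF assms]
    by (metis fps_conv_radius_sinc)
  have "sinc_fps * power_fps q = g * (?L * power_fps q)"
    by (simp add: g(1) mult_ac)
  then have eq: "sinc_fps * power_fps q = - (fps_X * g)"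
    by (simp add: power_fps_mult[OF assms])
  have rad: "fps_conv_radius (fps_X * g) = \<infinity>"
    using fps_conv_radius_mult[of fps_X g] g(2) by simp
  then show "fps_conv_radius (sinc_fps * power_fps q) = \<infinity>"
    by (simp add: eq)
  assume n: "n > 0"
  have ev: "eval_fps (sinc_fps * power_fps q) w = - w * eval_fps g w" for w
    using rad g(2) by (simp add: eq eval_fps_minus eval_fps_mult)
  show "eval_fps (sinc_fps * power_fps q) (of_nat n ^ 2) = (if q = n then - ((- 1) ^ n / 2) else 0)"
  proof (cases "q = n")
    case True
    then show ?thesis
      using n deriv_sinc_fps_nat_square[OF n] g(3) unfolding ev by simp
  next
    case False
    have lin: "fps_conv_radius ?L = \<infinity>"
      using fps_conv_radius_diff[of fps_X "fps_const (of_nat q ^ 2)" ] by simp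
    have "0 = eval_fps (?L * g) (of_nat n ^ 2)"
      using eval_sinc_fps_nat_square[OF n] g(1) by simp
    also have "\<dots> = (of_nat n ^ 2 - of_nat q ^ 2) * eval_fps g (of_nat n ^ 2)"
      using g(2) lin by (simp add: eval_fps_mult eval_fps_diff)
    finally have "(of_nat n ^ 2 - of_nat q ^ 2 :: complex) = 0 \<or> eval_fps g (of_nat n ^ 2) = 0"
      by simp
    moreover have "(of_nat n ^ 2 - of_nat q ^ 2 :: complex) \<noteq> 0"
    proof
      assume "(of_nat n ^ 2 - of_nat q ^ 2 :: complex) = 0"
      then have "of_nat (n ^ 2) = (of_nat (q ^ 2) :: complex)" by simp
      then show False using False by (simp only: of_nat_eq_iff) simp
    qed
    ultimately show ?thesis using False by (simp add: ev)
  qed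
qed

section \<open>Series with finitely many pole terms up to a small error, and their values at
  \<open>n^2\<close>\<close>

lemma fps_conv_radius_sum:
  fixes f :: "'a \<Rightarrow> complex fps"
  assumes "\<And>j. j \<in> J \<Longrightarrow> fps_conv_radius (f j) = \<infinity>"
  shows "fps_conv_radius (\<Sum>j\<in>J. f j) = \<infinity>"
  using assms
proof (induction J rule: infinite_finite_induct)
  case (insert j J)
  then show ?case using fps_conv_radius_add[of "f j" "\<Sum>j\<in>J. f j"] by simp
qed auto

lemma eval_fps_sum:
  fixes f :: "'a \<Rightarrow> complex fps"
  assumes "\<And>j. j \<in> J \<Longrightarrow> fps_conv_radius (f j) = \<infinity>"
  shows "eval_fps (\<Sum>j\<in>J. f j) w = (\<Sum>j\<in>J. eval_fps (f j) w)"
  using assms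
proof (induction J rule: infinite_finite_induct)
  case (insert j J)
  then show ?case by (simp add: eval_fps_add fps_conv_radius_sum)
qed auto

text \<open>Only the terms of a Dirichlet series with index at most \<open>n\<close> matter for the value at \<open>n\<^sup>2\<close>; the
  error bound says that the rest has radius of convergence larger than \<open>n\<^sup>2\<close>.\<close>
definition power_expansion ::
  "nat \<Rightarrow> (nat \<Rightarrow> complex) \<Rightarrow> 'a set \<Rightarrow> ('a \<Rightarrow> complex) \<Rightarrow> ('a \<Rightarrow> nat) \<Rightarrow> bool" where
  "power_expansion n u J c q \<longleftrightarrow> finite J \<and> (\<forall>j\<in>J. q j > 0) \<and>
     (\<exists>K. \<forall>i>0. norm (u i - (\<Sum>j\<in>J. c j * (1 / of_nat (q j) ^ 2) ^ i)) \<le> K * (1 / real (Suc n) ^ 2) ^ i)"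

text \<open>\<open>U\<close> splits into a finite pole part \<open>P\<close> and a remainder
  \<open>V\<close> that converges beyond \<open>n^2\<close>. The product of \<open>sinc_fps\<close>
  with \<open>V\<close> vanishes at \<open>n^2\<close>, so only the poles of \<open>P\<close>
  located exactly at \<open>n^2\<close> contribute.\<close>

lemma sinc_fps_mult_power_expansion:
  assumes exp: "power_expansion n (fps_nth U) J c q" and n: "n > 0"
  shows "fps_conv_radius (sinc_fps * U) > ereal (real n ^ 2)"
    and "eval_fps (sinc_fps * U) (of_nat n ^ 2) = - ((- 1) ^ n / 2) * (\<Sum>j | j \<in> J \<and> q j = n. c j)"
proof -
  from exp obtain K where J: "finite J" and q: "\<And>j. j \<in> J \<Longrightarrow> q j > 0"
    and K: "\<And>i. i > 0 \<Longrightarrow> norm (fps_nth U i - (\<Sum>j\<in>J. c j * (1 / of_nat (q j) ^ 2) ^ i)) \<le> K * (1 / real (Suc n) ^ 2) ^ i"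
    unfolding power_expansion_def by blast
  define P where "P = (\<Sum>j\<in>J. fps_const (c j) * power_fps (q j))"
  define V where "V = U - P"
  \<comment> \<open>The constant coefficient is not controlled, but a single coefficient does not
    affect the radius of convergence.\<close>
  have V: "norm (fps_nth V i) \<le> K * (1 / real (Suc n) ^ 2) ^ i" if "i > 0" for i
    using K[OF that] that by (simp add: V_def P_def fps_sum_nth power_fps_def)
  have "fps_conv_radius V \<ge> ereal (real (Suc n) ^ 2)"
    unfolding fps_conv_radius_def
  proof (rule conv_radius_geI_ex')
    fix r :: real
    assume r: "0 < r" "ereal r < ereal (real (Suc n) ^ 2)"
    define t where "t = r / real (Suc n) ^ 2"
    have t: "0 \<le> t" "t < 1" using r by (auto simp: t_def)
    have "summable (\<lambda>i. K * t ^ i)"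
      using t by (intro summable_mult summable_geometric) auto
    then show "summable (\<lambda>i. fps_nth V i * of_real r ^ i)"
    proof (rule summable_comparison_test')
      fix i :: nat
      assume "i \<ge> 1"
      then have "norm (fps_nth V i * of_real r ^ i) \<le> K * (1 / real (Suc n) ^ 2) ^ i * r ^ i"
        using V[of i] r by (simp add: norm_mult norm_power mult_right_mono)
      then show "norm (fps_nth V i * of_real r ^ i) \<le> K * t ^ i"
        by (simp add: t_def power_divide)
    qed
  qed
  moreover have "ereal (real n ^ 2) < ereal (real (Suc n) ^ 2)"
    by (simp add: power2_eq_square algebra_simps)
  ultimately have radV: "fps_conv_radius V > ereal (real n ^ 2)"
    by (meson less_le_trans)
  have sP: "sinc_fps * P = (\<Sum>j\<in>J. fps_const (c j) * (sinc_fps * power_fps (q j)))"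
    by (simp add: P_def sum_distrib_left mult_ac)
  have radT: "fps_conv_radius (fps_const (c j) * (sinc_fps * power_fps (q j))) = \<infinity>" if "j \<in> J" for j
    using fps_conv_radius_mult[of "fps_const (c j)" "sinc_fps * power_fps (q j)"]
      sinc_times_power_fps(1)[OF q[OF that]] by simp
  have radP: "fps_conv_radius (sinc_fps * P) = \<infinity>"
    unfolding sP by (intro fps_conv_radius_sum radT)
  have "fps_conv_radius (sinc_fps * V) \<ge> fps_conv_radius V"
    using fps_conv_radius_mult[of sinc_fps V] by simp
  with radV have radSV: "fps_conv_radius (sinc_fps * V) > ereal (real n ^ 2)"
    by (rule less_le_trans)
  have split: "sinc_fps * U = sinc_fps * P + sinc_fps * V"
    by (simp add: V_def algebra_simps)
  show "fps_conv_radius (sinc_fps * U) > ereal (real n ^ 2)"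
    using fps_conv_radius_add[of "sinc_fps * P" "sinc_fps * V"] radSV radP
    unfolding split by (auto intro: less_le_trans)
  have "eval_fps (sinc_fps * U) (of_nat n ^ 2)
      = eval_fps (sinc_fps * P) (of_nat n ^ 2) + eval_fps sinc_fps (of_nat n ^ 2) * eval_fps V (of_nat n ^ 2)"
    using radV radSV radP unfolding split
    by (simp add: eval_fps_add eval_fps_mult norm_power)
  also have "\<dots> = (\<Sum>j\<in>J. c j * (if q j = n then - ((- 1) ^ n / 2) else 0))"
    unfolding sP eval_sinc_fps_nat_square[OF n]
    by (simp add: eval_fps_sum[OF radT] eval_fps_mult sinc_times_power_fps q n cong: sum.cong)
  also have "\<dots> = (\<Sum>j | j \<in> J \<and> q j = n. c j * (- ((- 1) ^ n / 2)))"
    using J by (intro sum.mono_neutral_cong_right) auto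
  also have "\<dots> = - ((- 1) ^ n / 2) * (\<Sum>j | j \<in> J \<and> q j = n. c j)"
    by (simp add: sum_distrib_left mult_ac)
  finally show "eval_fps (sinc_fps * U) (of_nat n ^ 2) = - ((- 1) ^ n / 2) * (\<Sum>j | j \<in> J \<and> q j = n. c j)" .
qed


section \<open>Zeta at even integers and the sieved Euler product\<close>

definition even_zeta :: "nat \<Rightarrow> real" where
  "even_zeta i = (\<Sum>\<^sub>\<infinity>m\<in>{0<..}. (1 / real m ^ 2) ^ i)"

lemma has_sum_even_zeta:
  assumes "i > 0"
  shows "((\<lambda>m. (1 / real m ^ 2) ^ i) has_sum even_zeta i) {0<..}"
proof -
  have "summable (\<lambda>m. (1 / real m ^ 2) ^ i)"
    using inverse_power_summable[of "2 * i", where 'a = real] assms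
    by (simp add: power_mult power_divide inverse_eq_divide)
  then have "(\<lambda>m. (1 / real m ^ 2) ^ i) summable_on UNIV"
    by (rule summable_nonneg_imp_summable_on) simp
  then show ?thesis
    unfolding even_zeta_def by (intro has_sum_infsum) (rule summable_on_subset, auto)
qed

lemma zeta_even:
  assumes "i > 0"
  shows "zeta (of_nat (2 * i)) = of_real (even_zeta i)"
proof -
  have "((\<lambda>m. (1 / real m ^ 2) ^ i) has_sum even_zeta i) (Suc ` UNIV)"
    using has_sum_even_zeta[OF assms] by (simp add: greaterThan_0)
  then have "((\<lambda>n. (1 / real (Suc n) ^ 2) ^ i) has_sum even_zeta i) UNIV"
    by (subst (asm) has_sum_reindex) (simp_all add: o_def del: of_nat_Suc)
  then have "(\<lambda>n. (1 / real (Suc n) ^ 2) ^ i) sums even_zeta i"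
    by (rule has_sum_imp_sums)
  then have "(\<lambda>n. complex_of_real ((1 / real (Suc n) ^ 2) ^ i)) sums of_real (even_zeta i)"
    by (simp only: sums_of_real_iff)
  moreover have "of_nat (Suc n) powr (- of_nat (2 * i)) = complex_of_real ((1 / real (Suc n) ^ 2) ^ i)" for n
  proof -
    have "of_nat (Suc n) powr (- of_nat (2 * i)) = inverse (of_nat (Suc n) ^ (2 * i) :: complex)"
      unfolding powr_minus by (subst powr_complexpow) (auto simp del: of_nat_Suc)
    then show ?thesis
      by (simp add: power_mult power_divide inverse_eq_divide del: of_nat_Suc)
  qed
  ultimately have "zeta_series (of_nat (2 * i)) = of_real (even_zeta i)"
    unfolding zeta_series_def by (simp only: sums_iff)
  moreover have "Re (of_nat (2 * i)) > 1"
    using assms by simp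
  ultimately show ?thesis
    unfolding zeta_def by (simp only: if_True)
qed

text \<open>Induction on the set of sieving primes. Among the numbers coprime to \<open>P\<close>,
  the multiples of a new prime \<open>p\<close> are exactly \<open>p\<close> times that same set, so
  removing them multiplies the sum by \<open>1 - (1 / p^2) ^ i\<close>.\<close>

lemma has_sum_sieve:
  assumes "finite P" "\<And>p. p \<in> P \<Longrightarrow> prime p" "i > 0"
  shows "((\<lambda>m. (1 / real m ^ 2) ^ i) has_sum even_zeta i * (\<Prod>p\<in>P. 1 - (1 / real p ^ 2) ^ i))
    {m. m > 0 \<and> (\<forall>p\<in>P. \<not> p dvd m)}"
  using assms(1,2)
proof (induction P)
  case empty
  then show ?case using has_sum_even_zeta[OF assms(3)] by (simp add: greaterThan_def)
next
  case (insert p P)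
  let ?f = "\<lambda>m. (1 / real m ^ 2) ^ i"
  let ?S = "even_zeta i * (\<Prod>p\<in>P. 1 - (1 / real p ^ 2) ^ i)"
  let ?R = "\<lambda>P. {m. m > 0 \<and> (\<forall>p\<in>P. \<not> p dvd m)} :: nat set"
  have p: "prime p" using insert.prems by auto
  have IH: "(?f has_sum ?S) (?R P)"
    using insert.IH insert.prems by auto
  have "((\<lambda>m. ?f p * ?f m) has_sum ?f p * ?S) (?R P)"
    using IH by (rule has_sum_cmult_right)
  moreover have "?f p * ?f m = ?f (p * m)" for m
    by (simp add: power_mult_distrib flip: power_mult_distrib)
  ultimately have "(?f has_sum ?f p * ?S) ((*) p ` ?R P)"
    using p by (subst has_sum_reindex) (auto simp: inj_on_def o_def)
  moreover have sub: "(*) p ` ?R P \<subseteq> ?R P"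
  proof (intro image_subsetI CollectI conjI ballI notI)
    fix m q assume m: "m \<in> ?R P" and q: "q \<in> P" "q dvd p * m"
    have "prime q" using q insert.prems by auto
    with q m have "q dvd p" by (auto simp: prime_dvd_mult_iff)
    then have "q = p" using p \<open>prime q\<close> by (simp add: primes_dvd_imp_eq)
    with q insert.hyps show False by simp
  qed (use p in \<open>auto simp: prime_gt_0_nat\<close>)
  ultimately have "(?f has_sum ?S - ?f p * ?S) (?R P - (*) p ` ?R P)"
    using IH by (intro has_sum_Diff)
  moreover have "?R P - (*) p ` ?R P = ?R (insert p P)"
  proof (intro equalityI subsetI)
    fix m assume m: "m \<in> ?R P - (*) p ` ?R P"
    have "\<not> p dvd m"
    proof
      assume "p dvd m"
      then obtain k where k: "m = p * k" ..
      then have "k \<in> ?R P" using m by auto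
      then show False using m k by blast
    qed
    then show "m \<in> ?R (insert p P)" using m by auto
  qed auto
  moreover have "?S - ?f p * ?S = even_zeta i * (\<Prod>p\<in>insert p P. 1 - ?f p)"
    using insert.hyps by (simp add: algebra_simps)
  ultimately show ?case by simp
qed

definition primes_upto :: "nat \<Rightarrow> nat set" where
  "primes_upto n = {p. prime p \<and> p \<le> n}"

lemma finite_primes_upto [simp]: "finite (primes_upto n)"
  by (rule finite_subset[of _ "{..n}"]) (auto simp: primes_upto_def)

text \<open>The part of the Euler product of \<open>zeta (2 * i)\<close> coming from primes above
  \<open>n\<close>; by the sieve it is the sum over all \<open>m\<close> without prime factors up to
  \<open>n\<close>.\<close>

definition euler_remainder :: "nat \<Rightarrow> nat \<Rightarrow> real" where
  "euler_remainder n i = even_zeta i * (\<Prod>p\<in>primes_upto n. 1 - (1 / real p ^ 2) ^ i)"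

text \<open>The term \<open>m = 1\<close> contributes 1. Every other surviving \<open>m\<close> has
  a prime factor above \<open>n\<close>, hence \<open>m \<ge> n + 1\<close>.\<close>

lemma euler_remainder_bounds:
  assumes i: "i > 0"
  shows "euler_remainder n i \<ge> 1"
    and "euler_remainder n i - 1 \<le> real (Suc n) ^ 2 * even_zeta 1 * (1 / real (Suc n) ^ 2) ^ i"
proof -
  let ?f = "\<lambda>i m. (1 / real m ^ 2) ^ i"
  let ?R = "{m. m > 0 \<and> (\<forall>p\<in>primes_upto n. \<not> p dvd m)}"
  have "(?f i has_sum euler_remainder n i) ?R"
    unfolding euler_remainder_def by (rule has_sum_sieve) (use i in \<open>auto simp: primes_upto_def\<close>)
  moreover have "(?f i has_sum 1) {1}"
    using has_sum_finite[of "{1}" "?f i"] by simp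
  moreover have "{1} \<subseteq> ?R"
    by (auto simp: primes_upto_def)
  ultimately have rest: "(?f i has_sum (euler_remainder n i - 1)) (?R - {1})"
    by (intro has_sum_Diff)
  then show "euler_remainder n i \<ge> 1"
    using has_sum_nonneg[OF rest] by simp
  have "((\<lambda>m. real (Suc n) ^ 2 * (1 / real (Suc n) ^ 2) ^ i * ?f 1 m)
      has_sum real (Suc n) ^ 2 * (1 / real (Suc n) ^ 2) ^ i * even_zeta 1) {0<..}"
    by (intro has_sum_cmult_right has_sum_even_zeta) simp
  then have "euler_remainder n i - 1 \<le> real (Suc n) ^ 2 * (1 / real (Suc n) ^ 2) ^ i * even_zeta 1"
  proof (rule has_sum_mono_neutral[OF rest])
    fix m assume "m \<in> (?R - {1}) \<inter> {0<..}"
    then have m: "m > 0" "m \<noteq> 1" "\<And>p. prime p \<Longrightarrow> p \<le> n \<Longrightarrow> \<not> p dvd m"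
      by (auto simp: primes_upto_def)
    obtain p where p: "prime p" "p dvd m" using m(2) prime_factor_nat by blast
    have "p > n" using m(3) p by (meson not_le)
    moreover have "p \<le> m" using p m(1) by (simp add: dvd_imp_le)
    ultimately have "1 / real m ^ 2 \<le> 1 / real (Suc n) ^ 2"
      by (intro divide_left_mono power_mono) auto
    \<comment> \<open>One factor \<open>1 / m^2\<close> is kept so that the bound stays summable
      over \<open>m\<close>; the remaining \<open>i - 1\<close> factors are estimated. The constant
      \<open>(n + 1)^2\<close> makes up for the exponent \<open>i - 1\<close> in place of
      \<open>i\<close>.\<close>
    then have "?f (i - 1) m * ?f 1 m \<le> (1 / real (Suc n) ^ 2) ^ (i - 1) * ?f 1 m"
      by (intro mult_right_mono power_mono) auto
    moreover have "?f i m = ?f (i - 1) m * ?f 1 m"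
      using i by (cases i) simp_all
    moreover have "(1 / real (Suc n) ^ 2) ^ (i - 1) = real (Suc n) ^ 2 * (1 / real (Suc n) ^ 2) ^ i"
      using i by (cases i) (auto simp del: of_nat_Suc)
    ultimately show "?f i m \<le> real (Suc n) ^ 2 * (1 / real (Suc n) ^ 2) ^ i * ?f 1 m"
      by simp
  qed auto
  then show "euler_remainder n i - 1 \<le> real (Suc n) ^ 2 * even_zeta 1 * (1 / real (Suc n) ^ 2) ^ i"
    by (simp add: mult_ac)
qed

lemma prime_term_bounds:
  assumes "prime p" "i > 0"
  shows "0 < (1 / real p ^ 2) ^ i" "(1 / real p ^ 2) ^ i \<le> 1 / 4"
proof -
  have p: "real p \<ge> 2" using prime_ge_2_nat[OF assms(1)] by simp
  then show "0 < (1 / real p ^ 2) ^ i" by simp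
  have "real p ^ 2 \<ge> 2 ^ 2" using p by (intro power_mono) auto
  then have le: "1 / real p ^ 2 \<le> 1 / 4" using p by (intro divide_left_mono) auto
  have "(1 / real p ^ 2) ^ i \<le> (1 / real p ^ 2) ^ 1"
    using le assms(2) by (intro power_decreasing) auto
  with le show "(1 / real p ^ 2) ^ i \<le> 1 / 4" by simp
qed

section \<open>Pole expansions of the series of \<open>1 / zeta\<close> and of
  \<open>ln zeta\<close>\<close>

lemma inverse_even_zeta_eq:
  assumes "i > 0"
  shows "1 / even_zeta i = (\<Prod>p\<in>primes_upto n. 1 - (1 / real p ^ 2) ^ i) / euler_remainder n i"
    and "(\<Prod>p\<in>primes_upto n. 1 - (1 / real p ^ 2) ^ i) > 0"
    and "even_zeta i > 0"
proof -
  show *: "(\<Prod>p\<in>primes_upto n. 1 - (1 / real p ^ 2) ^ i) > 0"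
  proof (rule prod_pos)
    fix p assume "p \<in> primes_upto n"
    then have "(1 / real p ^ 2) ^ i \<le> 1 / 4"
      using assms by (intro prime_term_bounds) (auto simp: primes_upto_def)
    then show "0 < 1 - (1 / real p ^ 2) ^ i" by linarith
  qed
  show "even_zeta i > 0"
    using euler_remainder_bounds(1)[OF assms, of n] *
    unfolding euler_remainder_def by (metis less_le_trans zero_less_mult_pos2 zero_less_one)
  show "1 / even_zeta i = (\<Prod>p\<in>primes_upto n. 1 - (1 / real p ^ 2) ^ i) / euler_remainder n i"
  proof -
    have "1 / z = Q / (z * Q)" if "Q > 0" for z Q :: real
      using that by simp
    from this[OF *] show ?thesis unfolding euler_remainder_def .
  qed
qed

lemma prod_primes_expand:
  "(\<Prod>p\<in>primes_upto n. 1 - (1 / real p ^ 2) ^ i)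
     = (\<Sum>X\<in>Pow (primes_upto n). (- 1) ^ card X * (1 / real (\<Prod>X) ^ 2) ^ i)"
proof -
  have "(\<Prod>p\<in>primes_upto n. 1 - (1 / real p ^ 2) ^ i)
      = (\<Prod>p\<in>primes_upto n. (- 1) * (1 / real p ^ 2) ^ i + 1)"
    by simp
  also have "\<dots> = (\<Sum>X\<in>Pow (primes_upto n). (\<Prod>p\<in>X. (- 1) * (1 / real p ^ 2) ^ i))"
    by (subst prod_add) simp_all
  also have "\<dots> = (\<Sum>X\<in>Pow (primes_upto n). (- 1) ^ card X * (1 / real (\<Prod>X) ^ 2) ^ i)"
    by (intro sum.cong refl)
      (simp only: prod.distrib prod_constant of_nat_prod prod_dividef prod_power_distrib prod.neutral_const
        power_divide power_one)
  finally show ?thesis .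
qed

text \<open>\<open>1 / zeta\<close> is the finite product over primes up to \<open>n\<close> divided
  by the Euler remainder. Expanded, the product runs over squarefree numbers with the Moebius sign,
  one for each set \<open>X\<close> of primes.\<close>

lemma inverse_zeta_power_expansion:
  assumes "\<And>i. i > 0 \<Longrightarrow> u i = 1 / zeta (of_nat (2 * i))"
  shows "power_expansion n u (Pow (primes_upto n)) (\<lambda>X. (- 1) ^ card X) (\<lambda>X. \<Prod>X)"
  unfolding power_expansion_def
proof (intro conjI ballI exI allI impI)
  fix X assume "X \<in> Pow (primes_upto n)"
  then show "\<Prod>X > 0" by (intro prod_pos) (auto simp: primes_upto_def prime_gt_0_nat)
next
  fix i :: nat assume i: "i > 0"
  let ?Q = "\<Prod>p\<in>primes_upto n. 1 - (1 / real p ^ 2) ^ i" and ?r = "euler_remainder n i"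
  have "0 \<le> 1 - (1 / real p ^ 2) ^ i \<and> 1 - (1 / real p ^ 2) ^ i \<le> 1" if "p \<in> primes_upto n" for p
    using prime_term_bounds[of p i] i that unfolding primes_upto_def by force
  then have Q: "0 < ?Q" "?Q \<le> 1"
    using inverse_even_zeta_eq(2)[OF i] by (auto simp only: intro!: prod_le_1)
  have r: "?r \<ge> 1" by (rule euler_remainder_bounds(1)[OF i])
  \<comment> \<open>Since \<open>Q \<le> 1 \<le> r\<close>, replacing \<open>Q / r\<close> by
    \<open>Q\<close> costs at most \<open>r - 1\<close>, which is already known to be small.\<close>
  have "?Q - ?Q / ?r = ?Q * ((?r - 1) / ?r)"
    using r by (simp add: field_simps)
  also have "\<dots> \<le> 1 * (?r - 1)"
    using Q r by (intro mult_mono) (auto simp: divide_le_eq mult_le_cancel_left1)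
  finally have "\<bar>?Q / ?r - ?Q\<bar> \<le> ?r - 1"
    using Q r by (simp add: abs_le_iff divide_le_eq mult_le_cancel_left1)
  moreover have "u i - (\<Sum>X\<in>Pow (primes_upto n). (- 1) ^ card X * (1 / of_nat (\<Prod>X) ^ 2) ^ i) = of_real (?Q / ?r - ?Q)"
  proof -
    have "(\<Sum>X\<in>Pow (primes_upto n). (- 1) ^ card X * (1 / of_nat (\<Prod>X) ^ 2) ^ i) = complex_of_real ?Q"
      unfolding prod_primes_expand by simp
    moreover have "u i = of_real (?Q / ?r)"
      unfolding assms[OF i] zeta_even[OF i] inverse_even_zeta_eq(1)[OF i, of n, symmetric] by simp
    ultimately show ?thesis by (simp only: of_real_diff)
  qed
  ultimately have "norm (u i - (\<Sum>X\<in>Pow (primes_upto n). (- 1) ^ card X * (1 / of_nat (\<Prod>X) ^ 2) ^ i)) \<le> ?r - 1"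
    by (simp only: norm_of_real)
  then show "norm (u i - (\<Sum>X\<in>Pow (primes_upto n). (- 1) ^ card X * (1 / of_nat (\<Prod>X) ^ 2) ^ i))
      \<le> (real (Suc n) ^ 2 * even_zeta 1) * (1 / real (Suc n) ^ 2) ^ i"
    using euler_remainder_bounds(2)[OF i, of n] by linarith
qed simp

text \<open>The tail of the logarithm series is dominated by a geometric series, and
  \<open>1 / (1 - x) \<le> 2\<close> on this range.\<close>

lemma ln_one_minus_truncated:
  fixes x :: real
  assumes x: "0 \<le> x" "x \<le> 1 / 2"
  shows "\<bar>- ln (1 - x) - (\<Sum>k=1..n. x ^ k / real k)\<bar> \<le> 2 * x ^ Suc n"
proof -
  have s: "(\<lambda>k. x ^ k / real k) sums (- ln (1 - x))"
    using sums_minus[OF ln_series'[of "- x"]] x by simp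
  have "(\<Sum>k=1..n. x ^ k / real k) = (\<Sum>k<Suc n. x ^ k / real k)"
    by (rule sum.mono_neutral_left) auto
  with sums_split_initial_segment[OF s, of "Suc n"]
  have t: "(\<lambda>k. x ^ (k + Suc n) / real (k + Suc n)) sums (- ln (1 - x) - (\<Sum>k=1..n. x ^ k / real k))"
    by simp
  have g: "(\<lambda>k. x ^ Suc n * x ^ k) sums (x ^ Suc n * (1 / (1 - x)))"
    using x by (intro sums_mult geometric_sums) simp
  have "- ln (1 - x) - (\<Sum>k=1..n. x ^ k / real k) \<le> x ^ Suc n * (1 / (1 - x))"
  proof (rule sums_le[OF _ t g])
    fix k
    have "x ^ (k + Suc n) / real (k + Suc n) \<le> x ^ (k + Suc n) / 1"
      using x by (intro divide_left_mono) auto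
    then show "x ^ (k + Suc n) / real (k + Suc n) \<le> x ^ Suc n * x ^ k"
      by (simp add: power_add mult_ac)
  qed
  also have "\<dots> \<le> x ^ Suc n * 2"
    using x by (intro mult_left_mono) (auto simp: divide_le_eq)
  finally have "- ln (1 - x) - (\<Sum>k=1..n. x ^ k / real k) \<le> 2 * x ^ Suc n"
    by (simp add: mult_ac)
  moreover have "- ln (1 - x) - (\<Sum>k=1..n. x ^ k / real k) \<ge> 0"
    using x by (intro sums_le[OF _ sums_zero t]) auto
  ultimately show ?thesis by simp
qed

text \<open>The logarithm of the Euler product gives prime powers \<open>p ^ k\<close> with weight
  \<open>1 / k\<close>. Two errors arise: \<open>ln r\<close> from the primes above
  \<open>n\<close>, and the truncation of each logarithm after \<open>k = n\<close>.\<close>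

lemma ln_zeta_power_expansion:
  assumes "\<And>i. i > 0 \<Longrightarrow> u i = ln (zeta (of_nat (2 * i)))"
  shows "power_expansion n u (primes_upto n \<times> {1..n}) (\<lambda>(p, k). 1 / of_nat k) (\<lambda>(p, k). p ^ k)"
  unfolding power_expansion_def
proof (intro conjI ballI exI allI impI)
  fix j assume "j \<in> primes_upto n \<times> {1..n}"
  then show "(case j of (p, k) \<Rightarrow> p ^ k) > 0" by (auto simp: primes_upto_def prime_gt_0_nat)
next
  fix i :: nat assume i: "i > 0"
  let ?x = "\<lambda>p. (1 / real p ^ 2) ^ i" and ?r = "euler_remainder n i" and ?P = "primes_upto n"
  let ?e = "(1 / real (Suc n) ^ 2) ^ i"
  let ?S = "\<Sum>p\<in>?P. \<Sum>k=1..n. ?x p ^ k / real k"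
  have pr: "prime p" if "p \<in> ?P" for p using that by (simp add: primes_upto_def)
  note z = inverse_even_zeta_eq(2)[OF i, of n] inverse_even_zeta_eq(3)[OF i]
  have r: "?r \<ge> 1" by (rule euler_remainder_bounds(1)[OF i])
  have lnr: "0 \<le> ln ?r" "ln ?r \<le> ?r - 1"
    using r ln_le_minus_one[of ?r] by auto
  have pos: "1 - ?x p > 0" if "p \<in> ?P" for p
    using prime_term_bounds[OF pr[OF that] i] by simp
  have "ln ?r = ln (even_zeta i) + (\<Sum>p\<in>?P. ln (1 - ?x p))"
  proof -
    have "ln (\<Prod>p\<in>?P. 1 - ?x p) = (\<Sum>p\<in>?P. ln (1 - ?x p))"
      by (intro ln_prod) (simp, metis pos less_irrefl)
    then show ?thesis
      unfolding euler_remainder_def using z by (simp add: ln_mult_pos)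
  qed
  then have eq: "ln (even_zeta i) - ?S = ln ?r + (\<Sum>p\<in>?P. - ln (1 - ?x p) - (\<Sum>k=1..n. ?x p ^ k / real k))"
    by (simp add: sum_negf sum_subtractf)
  have "\<bar>- ln (1 - ?x p) - (\<Sum>k=1..n. ?x p ^ k / real k)\<bar> \<le> 2 * ?e" if p: "p \<in> ?P" for p
  proof -
    \<comment> \<open>The first omitted power is large enough:
      \<open>p ^ (n + 1) \<ge> 2 ^ (n + 1) > n + 1\<close>.\<close>
    have "Suc n \<le> p ^ Suc n"
      using less_exp[of "Suc n"] power_mono[of 2 p "Suc n"] prime_ge_2_nat[OF pr[OF p]] by linarith
    then have "real (Suc n) \<le> real p ^ Suc n"
      by (metis of_nat_le_iff of_nat_power)
    moreover have "real p > 0"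
      using prime_gt_0_nat[OF pr[OF p]] by simp
    ultimately have "(1 / (real p ^ Suc n) ^ 2) ^ i \<le> ?e"
      by (intro power_mono divide_left_mono mult_pos_pos zero_less_power) auto
    moreover have "?x p ^ Suc n = (1 / (real p ^ Suc n) ^ 2) ^ i"
      by (simp only: power_divide power_one flip: power_mult) (simp only: mult_ac)
    ultimately show ?thesis
      using ln_one_minus_truncated[of "?x p" n] prime_term_bounds[OF pr[OF p] i] by linarith
  qed
  then have "\<bar>\<Sum>p\<in>?P. - ln (1 - ?x p) - (\<Sum>k=1..n. ?x p ^ k / real k)\<bar> \<le> (\<Sum>p\<in>?P. 2 * ?e)"
    by (intro order_trans[OF sum_abs] sum_mono)
  then have "\<bar>ln (even_zeta i) - ?S\<bar> \<le> (?r - 1) + (\<Sum>p\<in>?P. 2 * ?e)"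
    unfolding eq using lnr by linarith
  then have bound: "\<bar>ln (even_zeta i) - ?S\<bar> \<le> (real (Suc n) ^ 2 * even_zeta 1 + 2 * card ?P) * ?e"
    using euler_remainder_bounds(2)[OF i, of n] by (simp add: algebra_simps)
  have "of_real ?S = (\<Sum>p\<in>?P. \<Sum>k=1..n. 1 / of_nat k * (1 / of_nat (p ^ k) ^ 2) ^ i :: complex)"
    unfolding of_real_sum
    by (intro sum.cong refl) (simp add: power_divide mult_ac flip: power_mult)
  also have "\<dots> = (\<Sum>j\<in>?P \<times> {1..n}. (case j of (p, k) \<Rightarrow> 1 / of_nat k) * (1 / of_nat (case j of (p, k) \<Rightarrow> p ^ k) ^ 2) ^ i)"
    unfolding sum.cartesian_product by (intro sum.cong) auto
  \<comment> \<open>\<open>zeta (2 * i)\<close> is a positive real, so the principal complex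
    logarithm agrees with the real one.\<close>
  finally have "u i - (\<Sum>j\<in>?P \<times> {1..n}. (case j of (p, k) \<Rightarrow> 1 / of_nat k) * (1 / of_nat (case j of (p, k) \<Rightarrow> p ^ k) ^ 2) ^ i)
      = of_real (ln (even_zeta i) - ?S)"
    unfolding assms[OF i] zeta_even[OF i] Ln_of_real[OF z(2)] of_real_diff by simp
  with bound show "norm (u i - (\<Sum>j\<in>?P \<times> {1..n}. (case j of (p, k) \<Rightarrow> 1 / of_nat k) * (1 / of_nat (case j of (p, k) \<Rightarrow> p ^ k) ^ 2) ^ i))
      \<le> (real (Suc n) ^ 2 * even_zeta 1 + 2 * card ?P) * ?e"
    by (simp only: norm_of_real)
qed simp

section \<open>Detecting primes by the two residue sums, and the coefficients of the product\<close>

lemma prime_indicator: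
  "(\<Sum>j | j \<in> primes_upto n \<times> {1..n} \<and> (case j of (p, k) \<Rightarrow> p ^ k) = n. (case j of (p, k) \<Rightarrow> 1 / of_nat k))
     * (\<Sum>X | X \<in> Pow (primes_upto n) \<and> \<Prod>X = n. (- 1) ^ card X)
   = (if prime n then - 1 else 0 :: complex)" (is "sum _ ?J * sum _ ?X = _")
proof -
  \<comment> \<open>A set of primes whose product is a power of \<open>p\<close> can contain nothing
    but \<open>p\<close>.\<close>
  have elem: "q = p" if "X \<in> Pow (primes_upto n)" "\<Prod>X = p ^ k" "q \<in> X" "prime p" for X q p k
  proof -
    have "finite X" using that by (auto intro: finite_subset[OF _ finite_primes_upto])
    then have "q dvd p ^ k" using that by (metis dvd_prodI)
    moreover have "prime q" using that by (auto simp: primes_upto_def)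
    ultimately show "q = p" using that by (metis prime_dvd_power primes_dvd_imp_eq)
  qed
  show ?thesis
  proof (cases "prime n")
    case True
    have "?J = {(n, 1)}"
    proof (intro equalityI subsetI)
      fix j assume "j \<in> ?J"
      then obtain p k where j: "j = (p, k)" "prime p" "k \<ge> 1" "p ^ k = n"
        by (auto simp: primes_upto_def)
      with True have "k = 1"
        by (metis prime_power_iff)
      with j show "j \<in> {(n, 1)}" by simp
    qed (use True in \<open>auto simp: primes_upto_def prime_gt_0_nat Suc_le_eq\<close>)
    moreover have "?X = {{n}}"
    proof (intro equalityI subsetI)
      fix X assume X: "X \<in> ?X"
      then have "X \<subseteq> {n}" using elem[of X n 1] True by auto
      moreover have "X \<noteq> {}" using X True by auto
      ultimately show "X \<in> {{n}}" by auto
    qed (use True in \<open>auto simp: primes_upto_def\<close>)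
    ultimately show ?thesis using True by simp
  next
    case False
    \<comment> \<open>A number that is both a prime power with positive exponent and a product of
      distinct primes is prime.\<close>
    have "?J = {} \<or> ?X = {}"
    proof (rule ccontr)
      assume "\<not> ?thesis"
      then obtain p k X where *: "prime p" "k \<ge> 1" "p ^ k = n" "X \<in> Pow (primes_upto n)" "\<Prod>X = n"
        by (auto simp: primes_upto_def)
      then have "X \<subseteq> {p}" using elem[of X p k] by auto
      then have "n = 1 \<or> n = p" using * by (auto simp: subset_singleton_iff)
      \<comment> \<open>This excludes the empty set \<open>X\<close>, whose product is 1: the
        exponent \<open>k\<close> is at least 1.\<close>
      moreover have "n \<noteq> 1"
        using * by (metis less_irrefl one_less_power prime_gt_1_nat Suc_le_eq One_nat_def)
      ultimately show False using False * by auto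
    qed
    then show ?thesis
      using False by (elim disjE) (simp_all only: sum.empty mult_zero_left mult_zero_right if_False)
  qed
qed

text \<open>A triple Cauchy product: \<open>a 0 = 0\<close> lets the outer sum start at 1, and the
  shift \<open>j = l + i\<close> gives the inner range \<open>i..h\<close>.\<close>

lemma coefficient_fps:
  fixes a b :: "nat \<Rightarrow> complex"
  assumes "a 0 = 0"
  shows "fps_nth (Abs_fps a * Abs_fps b * (sinc_fps * sinc_fps)) h
    = 2 * (\<Sum>i=1..h. a i * (\<Sum>j=i..h. b (j - i) * ((- 1) ^ (h - j) * (2 * of_real pi) ^ (2 * h - 2 * j) / fact (2 * h + 2 - 2 * j))))"
proof -
  define c :: "nat \<Rightarrow> complex" where "c = (\<lambda>m. (- 1) ^ m * (2 * of_real pi) ^ (2 * m) / fact (2 * m + 2))"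
  have sq: "fps_nth (sinc_fps * sinc_fps) m = 2 * c m" for m
    unfolding sinc_fps_square_nth c_def by simp
  have "fps_nth (Abs_fps a * Abs_fps b * (sinc_fps * sinc_fps)) h
      = (\<Sum>i=0..h. a i * (\<Sum>l=0..h - i. b l * (2 * c (h - i - l))))"
    unfolding mult.assoc[of "Abs_fps a"] fps_mult_nth[of "Abs_fps a"] fps_mult_nth[of "Abs_fps b"] sq by simp
  also have "\<dots> = (\<Sum>i=1..h. a i * (\<Sum>l=0..h - i. b l * (2 * c (h - i - l))))"
    using assms by (intro sum.mono_neutral_right) (auto simp: not_le)
  also have "\<dots> = (\<Sum>i=1..h. a i * (\<Sum>j=i..h. b (j - i) * (2 * c (h - j))))"
  proof -
    have "(\<Sum>l=0..h - i. b l * (2 * c (h - i - l))) = (\<Sum>j=i..h. b (j - i) * (2 * c (h - j)))"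
      if "i \<le> h" for i
      using that by (intro sum.reindex_bij_witness[of _ "\<lambda>j. j - i" "\<lambda>l. l + i"]) (auto simp: add.commute)
    then show ?thesis by (intro sum.cong refl) (simp only: atLeastAtMost_iff)
  qed
  also have "\<dots> = 2 * (\<Sum>i=1..h. a i * (\<Sum>j=i..h. b (j - i) * c (h - j)))"
    by (simp add: sum_distrib_left mult_ac)
  also have "(\<Sum>i=1..h. a i * (\<Sum>j=i..h. b (j - i) * c (h - j)))
      = (\<Sum>i=1..h. a i * (\<Sum>j=i..h. b (j - i) * ((- 1) ^ (h - j) * (2 * of_real pi) ^ (2 * h - 2 * j) / fact (2 * h + 2 - 2 * j))))"
  proof -
    have "c (h - j) = (- 1) ^ (h - j) * (2 * of_real pi) ^ (2 * h - 2 * j) / fact (2 * h + 2 - 2 * j)"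
      if "j \<le> h" for j
    proof -
      have "2 * h - 2 * j = 2 * (h - j)" "2 * h + 2 - 2 * j = 2 * (h - j) + 2" using that by auto
      then show ?thesis unfolding c_def by presburger
    qed
    then show ?thesis by (simp cong: sum.cong_simp)
  qed
  finally show ?thesis .
qed

section \<open>Evaluation at \<open>n^2\<close> and summation over \<open>n\<close>\<close>

definition prime_coeff :: "nat \<Rightarrow> complex" where
  "prime_coeff h = (\<Sum>i=1..h. ln (zeta (of_nat (2 * i))) *
     (\<Sum>j=i..h. (- 1) ^ (h - j) * (2 * complex_of_real pi) ^ (2 * h - 2 * j) /
        (zeta (of_nat (2 * j - 2 * i)) * fact (2 * h + 2 - 2 * j))))"

text \<open>One factor \<open>sinc_fps\<close> goes to each of the two series. At \<open>n^2\<close>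
  both products carry \<open>- (- 1) ^ n / 2\<close>, so the signs cancel and leave
  \<open>s * t / 4\<close>; the coefficients are twice \<open>prime_coeff\<close>, hence the
  8.\<close>

lemma prime_coeff_sums:
  assumes n: "n > 0"
  shows "(\<lambda>h. prime_coeff h * of_nat n ^ (2 * h)) sums (if prime n then - 1 / 8 else 0)"
proof -
  define a :: "nat \<Rightarrow> complex" where "a = (\<lambda>i. if i = 0 then 0 else ln (zeta (of_nat (2 * i))))"
  \<comment> \<open>The value of \<open>zeta 0\<close> only enters through the constant \<open>b 0\<close>, whose
    contribution is killed by the zero of \<open>sinc_fps\<close> at \<open>n\<^sup>2\<close>.\<close>
  define b :: "nat \<Rightarrow> complex" where "b = (\<lambda>i. 1 / zeta (of_nat (2 * i)))"
  define s where "s = (\<Sum>j | j \<in> primes_upto n \<times> {1..n} \<and> (case j of (p, k) \<Rightarrow> p ^ k) = n. ((case j of (p, k) \<Rightarrow> 1 / of_nat k) :: complex))"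
  define t where "t = (\<Sum>X | X \<in> Pow (primes_upto n) \<and> \<Prod>X = n. (- 1) ^ card X :: complex)"
  define FA where "FA = sinc_fps * Abs_fps a"
  define FB where "FB = sinc_fps * Abs_fps b"
  have "power_expansion n (fps_nth (Abs_fps a)) (primes_upto n \<times> {1..n}) (\<lambda>(p, k). 1 / of_nat k) (\<lambda>(p, k). p ^ k)"
    by (rule ln_zeta_power_expansion) (simp add: a_def)
  note A = sinc_fps_mult_power_expansion[OF this n, folded s_def FA_def]
  have "power_expansion n (fps_nth (Abs_fps b)) (Pow (primes_upto n)) (\<lambda>X. (- 1) ^ card X) (\<lambda>X. \<Prod>X)"
    by (rule inverse_zeta_power_expansion) (simp add: b_def)
  note B = sinc_fps_mult_power_expansion[OF this n, folded t_def FB_def]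
  have eq: "FA * FB = Abs_fps a * Abs_fps b * (sinc_fps * sinc_fps)"
    by (simp add: FA_def FB_def mult_ac)
  have nth: "fps_nth (FA * FB) h = 2 * prime_coeff h" for h
  proof -
    have "a 0 = 0" by (simp add: a_def)
    show ?thesis
      unfolding eq coefficient_fps[of a b h, OF \<open>a 0 = 0\<close>] prime_coeff_def
      by (intro arg_cong[of _ _ "(*) 2"] sum.cong refl arg_cong2[of _ _ _ _ "(*)"])
        (auto simp: a_def b_def right_diff_distrib' mult_ac)
  qed
  have "norm (of_nat n ^ 2 :: complex) = real n ^ 2"
    by (simp add: norm_power)
  then have *: "ereal (norm (of_nat n ^ 2 :: complex)) < fps_conv_radius FA" "ereal (norm (of_nat n ^ 2 :: complex)) < fps_conv_radius FB"
    using A(1) B(1) by simp_all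
  then have "ereal (norm (of_nat n ^ 2 :: complex)) < fps_conv_radius (FA * FB)"
    using fps_conv_radius_mult[of FA FB] by (metis less_le_trans min_less_iff_conj)
  then have "(\<lambda>h. fps_nth (FA * FB) h * (of_nat n ^ 2) ^ h) sums eval_fps (FA * FB) (of_nat n ^ 2)"
    unfolding eval_fps_def by (intro summable_sums summable_fps)
  also have "eval_fps (FA * FB) (of_nat n ^ 2) = s * t / 4"
  proof -
    have "eval_fps (FA * FB) (of_nat n ^ 2) = ((- 1) ^ n * (- 1) ^ n) * (s * t / 4)"
      unfolding eval_fps_mult[OF *] A(2) B(2) by simp
    also have "(- 1) ^ n * (- 1) ^ n = (1 :: complex)"
      by (simp flip: power_mult_distrib)
    finally show ?thesis by simp
  qed
  finally have "(\<lambda>h. 2 * (prime_coeff h * of_nat n ^ (2 * h))) sums (2 * (s * t / 8))"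
    by (simp only: nth power_mult mult.assoc) simp
  then have "(\<lambda>h. prime_coeff h * of_nat n ^ (2 * h)) sums (s * t / 8)"
    by (subst (asm) sums_mult_iff) simp_all
  also have "s * t = (if prime n then - 1 else 0)"
    unfolding s_def t_def by (rule prime_indicator)
  finally show ?thesis by (simp split: if_splits)
qed

theorem mainTheorem2:
  fixes x :: nat
  assumes "x > 0"
  shows "(\<lambda>N. - 8 * (\<Sum>h=1..N. of_nat (power_sum (2 * h) x) *
            (\<Sum>i=1..h. ln (zeta (of_nat (2 * i))) *
              (\<Sum>j=i..h. (- 1) ^ (h - j) * (2 * complex_of_real pi) ^ (2 * h - 2 * j) /
                 (zeta (of_nat (2 * j - 2 * i)) * fact (2 * h + 2 - 2 * j))))))
         \<longlonglongrightarrow> of_nat (prime_count x)"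
proof -
  have zero: "prime_coeff 0 = 0" by (simp add: prime_coeff_def)
  \<comment> \<open>Adding finitely many convergent series, one for each \<open>n \<le> x\<close>,
    turns the powers \<open>n ^ (2h)\<close> into the power sum.\<close>
  have "(\<lambda>h. \<Sum>n=1..x. prime_coeff h * of_nat n ^ (2 * h)) sums (\<Sum>n=1..x. if prime n then - 1 / 8 else 0)"
    by (intro sums_sum prime_coeff_sums) auto
  moreover have "(\<Sum>n=1..x. prime_coeff h * of_nat n ^ (2 * h)) = of_nat (power_sum (2 * h) x) * prime_coeff h" for h
    by (simp add: power_sum_def sum_distrib_left mult_ac)
  moreover have "(\<Sum>n=1..x. if prime n then - 1 / 8 else 0 :: complex) = - of_nat (prime_count x) / 8"
  proof -
    have "{n \<in> {1..x}. prime n} = {p. prime p \<and> p \<le> x}"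
      by (auto simp: prime_gt_0_nat Suc_le_eq)
    then show ?thesis
      by (simp add: prime_count_def flip: sum.inter_filter)
  qed
  ultimately have "(\<lambda>h. of_nat (power_sum (2 * h) x) * prime_coeff h) sums (- of_nat (prime_count x) / 8)"
    by simp
  then have "(\<lambda>N. - 8 * (\<Sum>h\<le>N. of_nat (power_sum (2 * h) x) * prime_coeff h)) \<longlonglongrightarrow> - 8 * (- of_nat (prime_count x) / 8)"
    unfolding sums_def_le by (rule tendsto_mult_left)
  \<comment> \<open>The series starts at \<open>h = 0\<close>, where \<open>prime_coeff\<close> is
    an empty sum, so the range may start at 1.\<close>
  moreover have "(\<Sum>h\<le>N. of_nat (power_sum (2 * h) x) * prime_coeff h) = (\<Sum>h=1..N. of_nat (power_sum (2 * h) x) * prime_coeff h)" for N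
    by (rule sum.mono_neutral_right) (auto simp: zero not_le)
  ultimately show ?thesis
    unfolding prime_coeff_def by simp
qed

end
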